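(* Let $\Lambda$ be a numerical semigroup with conductor $c$ whose right generators are $\sigma_1<\dots<\sigma_r$. Suppose that $2\leq i\leq r$ and that $\sigma_{i-1}\neq c$. Let $\tilde\Lambda=\Lambda\setminus\{\sigma_i\}$ and $\tilde\Lambda'=\Lambda\setminus\{\sigma_{i-1}\}$. If $\omega(\tilde\Lambda')=1$, then - $\omega(\tilde\Lambda)=1$, - $\overline{\tilde\Lambda}=\overline{\tilde\Lambda'}+\Lambda_{\{\sigma_{i-1},\dots,\sigma_i-1\}}$, - $c(\overline{\tilde\Lambda})\leq c(\overline{\tilde\Lambda'})$.
   Context: A numerical semigroup is a subset $\Lambda\subseteq\mathbb{N}_0$ containing $0$, closed under addition, with finite complement in $\mathbb{N}_0$. The Frobenius number is the largest element of $\mathbb{N}_0\setminus\Lambda$ (and $-1$ for $\mathbb{N}_0$). The conductor $c(\Lambda)$ is the smallest integer $c\geq 0$ such that all integers $n\geq c$ belong to $\Lambda$. The set of left elements $L(\Lambda)$ is the set of elements of $\Lambda$ smaller than the Frobenius number. The right generators of $\Lambda$ are the elements of its unique minimal generating set that are not left elements (equivalently, those $\geq c(\Lambda)$). If $\sigma$ is a right generator, $\Lambda\setminus\{\sigma\}$ is a numerical semigroup. For a numerical semigroup having nonzero left elements, $\omega(\Lambda)=\gcd(L(\Lambda))$, and the shrinking of $\Lambda$ is the numerical semigroup $\overline{\Lambda}=\left\langle\frac{L(\Lambda)}{\omega(\Lambda)}\right\rangle$ generated by the left elements divided by their gcd. For sets $A,B$ of integers, $A+B=\{a+b:a\in A,\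 b\in B\}$. $\Lambda_{\{k,\dots,l\}}$ denotes the submonoid of $\mathbb{N}_0$ generated by the interval of integers $\{k,k+1,\dots,l\}$ (which may consist of a single integer). *)

theory Defs
  imports Main "HOL.Hull" "HOL-Library.Set_Algebras"
begin

definition submonoid :: "nat set \<Rightarrow> bool" where
  "submonoid S \<longleftrightarrow> 0 \<in> S \<and> (\<forall>a\<in>S. \<forall>b\<in>S. a + b \<in> S)"

definition numerical_semigroup :: "nat set \<Rightarrow> bool" where
  "numerical_semigroup S \<longleftrightarrow> submonoid S \<and> finite (UNIV - S)"

definition generated :: "nat set \<Rightarrow> nat set" where
  "generated A = submonoid hull A"

definition frobenius :: "nat set \<Rightarrow> int" where
  "frobenius S = (if S = UNIV then -1 else int (Max (UNIV - S)))"

definition conductor :: "nat set \<Rightarrow> nat" where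
  "conductor S = (LEAST c. \<forall>n\<ge>c. n \<in> S)"

definition minimal_generating_set :: "nat set \<Rightarrow> nat set \<Rightarrow> bool" where
  "minimal_generating_set S G \<longleftrightarrow> generated G = S \<and> (\<forall>H. H \<subset> G \<longrightarrow> generated H \<noteq> S)"

(* Well-defined on submonoids, see ex1_minimal_generating_set below. *)
definition minimal_generators :: "nat set \<Rightarrow> nat set" where
  "minimal_generators S = (THE G. minimal_generating_set S G)"

definition left_elements :: "nat set \<Rightarrow> nat set" where
  "left_elements S = {x \<in> S. int x < frobenius S}"

definition right_generators :: "nat set \<Rightarrow> nat set" where
  "right_generators S = minimal_generators S - left_elements S"

(* Only meaningful if S has a nonzero left element; otherwise the value is 0. *)
definition left_gcd :: "nat set \<Rightarrow> nat" where
  "left_gcd S = Gcd (left_elements S)"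

definition shrinking :: "nat set \<Rightarrow> nat set" where
  "shrinking S = generated ((\<lambda>x. x div left_gcd S) ` left_elements S)"

lemma submonoid_generated: "submonoid (generated A)"
  unfolding generated_def by (rule hull_in) (auto simp: submonoid_def)

lemma subset_generated: "A \<subseteq> generated A"
  unfolding generated_def by (rule hull_subset)

lemma generated_minimal: "A \<subseteq> S \<Longrightarrow> submonoid S \<Longrightarrow> generated A \<subseteq> S"
  unfolding generated_def by (rule hull_minimal)

lemma ex1_minimal_generating_set:
  assumes S: "submonoid S"
  shows "\<exists>!G. minimal_generating_set S G"
proof -
  define B where "B = {x \<in> S. x \<noteq> 0 \<and> (\<forall>a\<in>S. \<forall>b\<in>S. a \<noteq> 0 \<longrightarrow> b \<noteq> 0 \<longrightarrow> x \<noteq> a + b)}"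
  have "x \<in> S \<Longrightarrow> x \<in> generated B" for x
  proof (induction x rule: less_induct)
    case (less x)
    show ?case
    proof (cases "x = 0 \<or> x \<in> B")
      case True
      then show ?thesis
        using submonoid_generated[of B] subset_generated[of B] by (auto simp: submonoid_def)
    next
      case False
      then obtain a b where "a \<in> S" "b \<in> S" "a \<noteq> 0" "b \<noteq> 0" "x = a + b"
        using less.prems by (auto simp: B_def)
      then show ?thesis
        using less.IH[of a] less.IH[of b] submonoid_generated[of B] by (auto simp: submonoid_def)
    qed
  qed
  moreover have "generated B \<subseteq> S"
    by (rule generated_minimal) (auto simp: B_def S)
  ultimately have gB: "generated B = S" by auto
  have sub: "B \<subseteq> G" if G: "generated G = S" for G
  proof
    fix x assume x: "x \<in> B"
    show "x \<in> G"
    proof (rule ccontr)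
      assume "x \<notin> G"
      moreover have "submonoid (S - {x})"
        unfolding submonoid_def
      proof (intro conjI ballI)
        show "0 \<in> S - {x}" using S x by (simp add: submonoid_def B_def)
        fix a b assume ab: "a \<in> S - {x}" "b \<in> S - {x}"
        then have "a + b \<in> S" using S by (simp add: submonoid_def)
        moreover have "a + b \<noteq> x"
        proof (cases "a = 0 \<or> b = 0")
          case True
          then show ?thesis using ab by auto
        next
          case False
          then show ?thesis using ab x unfolding B_def by blast
        qed
        ultimately show "a + b \<in> S - {x}" by simp
      qed
      ultimately have "generated G \<subseteq> S - {x}"
        using subset_generated[of G] G by (intro generated_minimal) auto
      then show False using G x by (auto simp: B_def)
    qed
  qed
  show ?thesis
  proof (rule ex1I[of _ B])
    show "minimal_generating_set S B"
      unfolding minimal_generating_set_def using gB sub by blast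
    show "G = B" if "minimal_generating_set S G" for G
      using that gB sub unfolding minimal_generating_set_def by blast
  qed
qed

end

theory Submission
  imports Defs
begin

text \<open>
  Removing an element \<open>s\<close> at or beyond the conductor makes \<open>s\<close> the new Frobenius number, so
  the left elements become exactly the elements of \<open>\<Lambda>\<close> below \<open>s\<close> (\<open>left_elements_remove\<close>).
  Write \<open>a\<close> and \<open>b\<close> for \<open>\<sigma> (i - 1)\<close> and \<open>\<sigma> i\<close>. As no gap lies at or above \<open>a\<close>, the left elements
  after removing \<open>b\<close> are those after removing \<open>a\<close> together with the whole interval from \<open>a\<close> to
  \<open>b - 1\<close>. Enlarging a set of gcd 1 keeps the gcd 1, so both shrinkings are generated by the left
  elements themselves, and the monoid generated by a union is the sum of the two generated
  monoids (\<open>generated_Un\<close>).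

  In particular the shrinking for \<open>a\<close> is contained in the one for \<open>b\<close>, and the conductors compare
  the other way, once the smaller monoid is known to be cofinite. This is the classical fact that
  a submonoid of the naturals with gcd 1 contains all large numbers (\<open>eventually_in_submonoid\<close>).
\<close>

lemma submonoid_mult:
  assumes "submonoid S" "x \<in> S"
  shows "k * x \<in> S"
  using assms by (induction k) (auto simp: submonoid_def)

text \<open>
  The integer differences of elements of \<open>S\<close> form a group; its positive generator divides all of
  \<open>S\<close>, so it is 1. The set \<open>D\<close> in the proof is the nonnegative part of that group.
\<close>

lemma consecutive_in_submonoid:
  assumes S: "submonoid S" and gcd: "Gcd S = 1"
  obtains s where "s \<in> S" "Suc s \<in> S"
proof -
  define D where "D = {d. \<exists>s\<in>S. s + d \<in> S}"
  have diff: "x - y \<in> D" if "x \<in> D" "y \<in> D" "y \<le> x" for x y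
  proof -
    obtain s t where st: "s \<in> S" "s + x \<in> S" "t \<in> S" "t + y \<in> S"
      using \<open>x \<in> D\<close> \<open>y \<in> D\<close> by (auto simp: D_def)
    have "s + (t + y) \<in> S" "(s + x) + t \<in> S"
      using S st by (auto simp: submonoid_def)
    moreover have "(s + x) + t = (s + (t + y)) + (x - y)"
      using \<open>y \<le> x\<close> by simp
    ultimately show ?thesis
      unfolding D_def by (auto intro!: bexI[of _ "s + (t + y)"])
  qed
  have SD: "S \<subseteq> D"
    using S by (auto simp: D_def submonoid_def)
  have "\<exists>x\<in>S. x \<noteq> 0"
  proof (rule ccontr)
    assume "\<not> ?thesis"
    then have "0 dvd Gcd S" by (intro Gcd_greatest) auto
    then show False using gcd by simp
  qed
  then have ex: "\<exists>d. d \<in> D \<and> d \<noteq> 0"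
    using SD by auto
  define d where "d = (LEAST d. d \<in> D \<and> d \<noteq> 0)"
  have d: "d \<in> D" "d \<noteq> 0"
    using LeastI_ex[OF ex] by (auto simp: d_def)
  have least: "d \<le> e" if "e \<in> D" "e \<noteq> 0" for e
    unfolding d_def using that by (intro Least_le) simp
  have dvd: "d dvd x" if "x \<in> D" for x
    using that
  proof (induction x rule: less_induct)
    case (less x)
    show ?case
    proof (cases "x = 0")
      case False
      then have "d \<le> x" using least less.prems by simp
      then have "d dvd x - d"
        using less.IH[of "x - d"] diff[of x d] less.prems d by simp
      then have "d dvd (x - d) + d" by (rule dvd_add) simp
      then show ?thesis using \<open>d \<le> x\<close> by simp
    qed simp
  qed
  have "d dvd Gcd S"
    using dvd SD by (intro Gcd_greatest) auto
  then have "d = 1" using gcd by simp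
  then show thesis
    using d that by (auto simp: D_def)
qed

text \<open>
  With \<open>s\<close> and \<open>s + 1\<close> in the monoid, a number \<open>q * s + r\<close> with \<open>r \<le> q\<close> is the sum of \<open>q - r\<close>
  copies of \<open>s\<close> and \<open>r\<close> copies of \<open>s + 1\<close>; from \<open>s\<^sup>2\<close> on, every quotient exceeds its remainder.
\<close>

lemma eventually_in_submonoid:
  assumes S: "submonoid S" and gcd: "Gcd S = 1"
  obtains c where "\<forall>n\<ge>c. n \<in> S"
proof -
  obtain s where s: "s \<in> S" "Suc s \<in> S"
    using consecutive_in_submonoid[OF assms] .
  have "n \<in> S" if n: "s * s \<le> n" for n
  proof (cases "s = 0")
    case True
    then show ?thesis using submonoid_mult[OF S s(2), of n] by simp
  next
    case False
    define q r where "q = n div s" and "r = n mod s"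
    have "s \<le> q"
      using False div_le_mono[OF n, of s] by (simp add: q_def)
    moreover have "r < s"
      using False by (simp add: r_def)
    ultimately have "r \<le> q" by linarith
    then have "(q - r) * s + r * Suc s = q * s + r"
      using mult_le_mono1[of r q s] by (simp add: diff_mult_distrib)
    also have "\<dots> = n" by (simp add: q_def r_def)
    finally have "n = (q - r) * s + r * Suc s" by simp
    moreover have "(q - r) * s + r * Suc s \<in> S"
      using S submonoid_mult[OF S s(1)] submonoid_mult[OF S s(2)] by (simp only: submonoid_def)
    ultimately show ?thesis by simp
  qed
  then show thesis using that by blast
qed

lemma Gcd_eq_1_superset:
  fixes A B :: "nat set"
  assumes "A \<subseteq> B" "Gcd A = 1"
  shows "Gcd B = 1"
proof -
  have "Gcd B dvd Gcd A"
    using assms(1) by (intro Gcd_greatest) (auto intro: Gcd_dvd)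
  then show ?thesis using assms(2) by simp
qed

lemma generated_mono: "A \<subseteq> B \<Longrightarrow> generated A \<subseteq> generated B"
  unfolding generated_def by (rule hull_mono)

lemma generated_Un: "generated (A \<union> B) = generated A + generated B"
proof
  have 0: "0 \<in> generated A" "0 \<in> generated B"
    using submonoid_generated by (auto simp: submonoid_def)
  have "submonoid (generated A + generated B)"
    unfolding submonoid_def
  proof (intro conjI ballI)
    show "0 \<in> generated A + generated B"
      using set_plus_intro[OF 0] by simp
    fix x y
    assume "x \<in> generated A + generated B" "y \<in> generated A + generated B"
    then obtain a b a' b' where
      ab: "x = a + b" "a \<in> generated A" "b \<in> generated B"
      and ab': "y = a' + b'" "a' \<in> generated A" "b' \<in> generated B"
      by (elim set_plus_elim)
    have "a + a' \<in> generated A" "b + b' \<in> generated B"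
      using ab ab' submonoid_generated by (auto simp: submonoid_def)
    then have "(a + a') + (b + b') \<in> generated A + generated B"
      by (rule set_plus_intro)
    then show "x + y \<in> generated A + generated B"
      using ab(1) ab'(1) by (simp add: ac_simps)
  qed
  moreover have "A \<union> B \<subseteq> generated A + generated B"
    using set_plus_intro[OF _ 0(2)] set_plus_intro[OF 0(1)] subset_generated
    by (fastforce simp: subset_iff)
  ultimately show "generated (A \<union> B) \<subseteq> generated A + generated B"
    by (intro generated_minimal)
next
  show "generated A + generated B \<subseteq> generated (A \<union> B)"
  proof
    fix x assume "x \<in> generated A + generated B"
    then obtain a b where "x = a + b" "a \<in> generated A" "b \<in> generated B"
      by (elim set_plus_elim)
    then show "x \<in> generated (A \<union> B)"
      using generated_mono[of A "A \<union> B"] generated_mono[of B "A \<union> B"]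
        submonoid_generated[of "A \<union> B"]
      by (auto simp: submonoid_def)
  qed
qed

lemma conductor_antimono:
  assumes "S \<subseteq> T" and "\<forall>n\<ge>c. n \<in> S"
  shows "conductor T \<le> conductor S"
proof -
  have "\<forall>n\<ge>conductor S. n \<in> S"
    unfolding conductor_def by (rule LeastI[of "\<lambda>c. \<forall>n\<ge>c. n \<in> S"]) (fact assms(2))
  then show ?thesis
    unfolding conductor_def[of T] using assms(1) by (intro Least_le) blast
qed

lemma in_of_ge_conductor:
  assumes "numerical_semigroup S" "conductor S \<le> n"
  shows "n \<in> S"
proof -
  obtain c where "\<forall>x\<in>UNIV - S. x < c"
    using assms(1) finite_nat_set_iff_bounded by (auto simp: numerical_semigroup_def)
  then have "\<forall>n\<ge>c. n \<in> S" by (auto simp: not_less[symmetric])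
  then have "\<forall>n\<ge>conductor S. n \<in> S"
    unfolding conductor_def by (rule LeastI[of "\<lambda>c. \<forall>n\<ge>c. n \<in> S"])
  then show ?thesis using assms(2) by blast
qed

lemma minimal_generators_subset:
  assumes "submonoid S"
  shows "minimal_generators S \<subseteq> S"
proof -
  have "minimal_generating_set S (minimal_generators S)"
    unfolding minimal_generators_def by (rule theI'[OF ex1_minimal_generating_set[OF assms]])
  then show ?thesis
    using subset_generated[of "minimal_generators S"] by (simp add: minimal_generating_set_def)
qed

text \<open>
  A right generator lies in \<open>S\<close> and is not below the Frobenius number, so no gap is at or above it.
\<close>

lemma conductor_le_right_generator:
  assumes S: "numerical_semigroup S" and x: "x \<in> right_generators S"
  shows "conductor S \<le> x"
  unfolding conductor_def
proof (intro Least_le allI impI)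
  fix n assume n: "x \<le> n"
  have xS: "x \<in> S"
    using S x minimal_generators_subset by (auto simp: right_generators_def numerical_semigroup_def)
  show "n \<in> S"
  proof (rule ccontr)
    assume nS: "n \<notin> S"
    have "n \<le> Max (UNIV - S)"
      using S nS by (intro Max_ge) (auto simp: numerical_semigroup_def)
    moreover have "x \<noteq> n" using xS nS by auto
    ultimately have "int x < frobenius S"
      using n nS by (auto simp: frobenius_def)
    then show False
      using x xS by (auto simp: right_generators_def left_elements_def)
  qed
qed

lemma left_elements_remove:
  assumes S: "numerical_semigroup S" and s: "conductor S \<le> s"
  shows "left_elements (S - {s}) = {x \<in> S. x < s}"
proof -
  have "Max (UNIV - (S - {s})) = s"
  proof (rule Max_eqI)
    have "UNIV - (S - {s}) \<subseteq> insert s (UNIV - S)" by auto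
    then show "finite (UNIV - (S - {s}))"
      using S by (auto simp: numerical_semigroup_def intro: finite_subset)
    show "y \<le> s" if y: "y \<in> UNIV - (S - {s})" for y
      using y in_of_ge_conductor[OF S, of y] s by force
  qed auto
  then have "frobenius (S - {s}) = int s"
    by (auto simp: frobenius_def)
  then show ?thesis by (auto simp: left_elements_def)
qed

lemma shrinking_eq_generated_left:
  "left_gcd S = 1 \<Longrightarrow> shrinking S = generated (left_elements S)"
  by (simp add: shrinking_def)

theorem lemma3p4:
  fixes \<Lambda> :: "nat set" and \<sigma> :: "nat \<Rightarrow> nat" and r i :: nat
  assumes "numerical_semigroup \<Lambda>"
    and "strict_mono_on {1..r} \<sigma>"
    and "right_generators \<Lambda> = \<sigma> ` {1..r}"
    and "2 \<le> i" and "i \<le> r"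
    and "\<sigma> (i - 1) \<noteq> conductor \<Lambda>"
    and "left_gcd (\<Lambda> - {\<sigma> (i - 1)}) = 1"
  shows "left_gcd (\<Lambda> - {\<sigma> i}) = 1
    \<and> shrinking (\<Lambda> - {\<sigma> i})
        = shrinking (\<Lambda> - {\<sigma> (i - 1)}) + generated {\<sigma> (i - 1)..\<sigma> i - 1}
    \<and> conductor (shrinking (\<Lambda> - {\<sigma> i})) \<le> conductor (shrinking (\<Lambda> - {\<sigma> (i - 1)}))"
proof -
  define a b where "a = \<sigma> (i - 1)" and "b = \<sigma> i"
  have "i - 1 \<in> {1..r}" "i \<in> {1..r}" "i - 1 < i"
    using assms(4,5) by auto
  then have ab: "a < b" and "a \<in> right_generators \<Lambda>"
    using strict_mono_onD[OF assms(2), of "i - 1" i] assms(3) unfolding a_def b_def by blast+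
  then have ca: "conductor \<Lambda> \<le> a"
    using conductor_le_right_generator[OF assms(1)] by simp
  define L' L where "L' = left_elements (\<Lambda> - {a})" and "L = left_elements (\<Lambda> - {b})"
  have "L' = {x \<in> \<Lambda>. x < a}" "L = {x \<in> \<Lambda>. x < b}"
    using left_elements_remove[OF assms(1)] ca ab by (auto simp: L'_def L_def)
  moreover have "x \<in> \<Lambda>" if "a \<le> x" for x
    using in_of_ge_conductor[OF assms(1)] ca that by simp
  ultimately have L: "L = L' \<union> {a..b - 1}"
    using ab by auto
  have gcd': "left_gcd (\<Lambda> - {a}) = 1"
    using assms(7) by (simp add: a_def)
  then have GL': "Gcd L' = 1"
    by (simp add: left_gcd_def L'_def)
  then have "Gcd L = 1"
    using L by (intro Gcd_eq_1_superset[of L' L]) auto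
  then have gcd: "left_gcd (\<Lambda> - {b}) = 1"
    by (simp add: left_gcd_def L_def)
  have shr': "shrinking (\<Lambda> - {a}) = generated L'"
    using shrinking_eq_generated_left[OF gcd'] by (simp add: L'_def)
  have shr: "shrinking (\<Lambda> - {b}) = generated L"
    using shrinking_eq_generated_left[OF gcd] by (simp add: L_def)
  have sum: "generated L = generated L' + generated {a..b - 1}"
    using L generated_Un by simp
  have "Gcd (generated L') = 1"
    using Gcd_eq_1_superset[OF subset_generated GL'] .
  then obtain c where "\<forall>n\<ge>c. n \<in> generated L'"
    using eventually_in_submonoid[OF submonoid_generated] by blast
  then have "conductor (generated L) \<le> conductor (generated L')"
    using L by (intro conductor_antimono generated_mono) auto
  then show ?thesis
    using gcd shr shr' sum by (simp add: a_def b_def)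
qed

end
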